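(* Let $q\in\{1,2,3,4\}$ and let $\alpha_0,\dots,\alpha_q$ and $\gamma_0,\dots,\gamma_{q-1}$ be the coefficients of the $q$-th order IMEX-BDF scheme. Then there exist a positive-definite Hermitian form $G(u_1,\dots,u_q)=\sum_{i,j=1}^q g_{ij}u_i\bar u_j$, a semi-positive-definite Hermitian form $A(u_1,\dots,u_{q-1})=\sum_{i,j=1}^{q-1}a_{ij}u_i\bar u_j$, linear forms $\sum_{i=1}^{q-1}\eta_iu_i$ and $\sum_{i=1}^q c_iu_i$, where all the coefficients $g_{ij},a_{ij},\eta_i,c_i$ are real, and real constants $d_1>0$ and $d_2$, such that $$\Re\left(\Big(\bar u_q-\sum_{j=1}^{q-1}\eta_j\bar u_j\Big)\sum_{i=0}^q\alpha_iu_i\right)=G(u_1,\dots,u_q)-G(u_0,\dots,u_{q-1})+d_1\left|u_q-\sum_{i=1}^{q-1}\eta_iu_i-d_2\sum_{i=0}^{q-1}\gamma_iu_i\right|^2$$ and $$\Re\left(\Big(\bar u_q-\sum_{i=1}^{q-1}\eta_i\bar u_i\Big)u_q\right)=A(u_2,\dots,u_q)-A(u_1,\dots,u_{q-1})+\left|\sum_{i=1}^qc_iu_i\right|^2$$ hold for all $u_0,u_1,\dots,u_q\in\mathbb{C}$.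
   Context: $\Re$ denotes the real part. For $q\ge 1$ the coefficients of the $q$-th order IMEX-BDF scheme are defined by $$\beta=\frac{1}{\sum_{j=1}^q\frac1j},\qquad \sum_{i=0}^q\alpha_i\zeta^i=\beta\sum_{j=1}^q\frac1j\,\zeta^{q-j}(\zeta-1)^j,\qquad \sum_{i=0}^{q-1}\gamma_i\zeta^i=\beta\big(\zeta^q-(\zeta-1)^q\big).$$ Explicitly: $q=1$: $\alpha=(-1,1)$, $\gamma=(1)$; $q=2$: $\alpha=(\frac13,-\frac43,1)$, $\gamma=(-\frac23,\frac43)$; $q=3$: $\alpha=(-\frac{2}{11},\frac{9}{11},-\frac{18}{11},1)$, $\gamma=(\frac{6}{11},-\frac{18}{11},\frac{18}{11})$; $q=4$: $\alpha=(\frac{3}{25},-\frac{16}{25},\frac{36}{25},-\frac{48}{25},1)$, $\gamma=(-\frac{12}{25},\frac{48}{25},-\frac{72}{25},\frac{48}{25})$. For $q=1$, empty sums and the form $A$ in zero variables are $0$. *)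

theory Defs
  imports Complex_Main "HOL-Computational_Algebra.Polynomial"
begin

definition bdf_beta :: "nat \<Rightarrow> real" where
  "bdf_beta q = 1 / (\<Sum>j=1..q. 1 / real j)"

definition bdf_alpha_poly :: "nat \<Rightarrow> real poly" where
  "bdf_alpha_poly q =
     smult (bdf_beta q) (\<Sum>j=1..q. smult (1 / real j) (monom 1 (q - j) * [:-1, 1:] ^ j))"

text \<open>The leading terms cancel, so for \<open>q \<ge> 1\<close> this polynomial has degree at most \<open>q - 1\<close>.\<close>

definition bdf_gamma_poly :: "nat \<Rightarrow> real poly" where
  "bdf_gamma_poly q = smult (bdf_beta q) (monom 1 q - [:-1, 1:] ^ q)"

definition bdf_alpha :: "nat \<Rightarrow> nat \<Rightarrow> real" where
  "bdf_alpha q i = coeff (bdf_alpha_poly q) i"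

definition bdf_gamma :: "nat \<Rightarrow> nat \<Rightarrow> real" where
  "bdf_gamma q i = coeff (bdf_gamma_poly q) i"

text \<open>A vector of \<open>n\<close> complex numbers is a function on \<open>nat\<close> of which only the values at
  \<open>1, \<dots>, n\<close> matter. The value of a form is kept complex; it is real when the coefficient
  matrix is Hermitian. For \<open>n = 0\<close> the form is \<open>0\<close>.\<close>

definition sesq_form :: "nat \<Rightarrow> (nat \<Rightarrow> nat \<Rightarrow> complex) \<Rightarrow> (nat \<Rightarrow> complex) \<Rightarrow> complex" where
  "sesq_form n m u = (\<Sum>i=1..n. \<Sum>j=1..n. m i j * u i * cnj (u j))"

definition hermitian_form :: "nat \<Rightarrow> (nat \<Rightarrow> nat \<Rightarrow> complex) \<Rightarrow> bool" where
  "hermitian_form n m \<longleftrightarrow> (\<forall>i\<in>{1..n}. \<forall>j\<in>{1..n}. m j i = cnj (m i j))"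

definition pos_def_hermitian :: "nat \<Rightarrow> (nat \<Rightarrow> nat \<Rightarrow> complex) \<Rightarrow> bool" where
  "pos_def_hermitian n m \<longleftrightarrow>
     hermitian_form n m \<and> (\<forall>u. (\<exists>i\<in>{1..n}. u i \<noteq> 0) \<longrightarrow> Re (sesq_form n m u) > 0)"

definition pos_semidef_hermitian :: "nat \<Rightarrow> (nat \<Rightarrow> nat \<Rightarrow> complex) \<Rightarrow> bool" where
  "pos_semidef_hermitian n m \<longleftrightarrow>
     hermitian_form n m \<and> (\<forall>u. Re (sesq_form n m u) \<ge> 0)"

end

theory Submission
  imports Defs
begin

text \<open>
  Write \<open>f(u)\<close> for the linear form with coefficients \<open>f\<^sub>1, \<dots>, f\<^sub>q\<close> in
  \<open>u\<^sub>1, \<dots>, u\<^sub>q\<close>, and \<open>g(u')\<close> for the form \<open>g\<close> in the shifted variables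
  \<open>u\<^sub>0, \<dots>, u\<^bsub>q-1\<^esub>\<close>. Put \<open>g = \<gamma> / q\<close>. The schemes satisfy
  \<open>\<alpha>\<^sub>0 = - \<gamma>\<^sub>0 / q\<close>, so \<open>\<alpha>(u) = f(u) - g(u')\<close> for a form \<open>f\<close> that does not
  contain \<open>u\<^sub>0\<close>. All coefficients are real, so every identity splits into its real and imaginary
  parts and may be proved for real \<open>u\<close>.

  Let \<open>e\<close> be a third form in \<open>u\<^sub>1, \<dots>, u\<^sub>q\<close> with \<open>d = f\<^sub>q + e\<^sub>q > 0\<close>, and
  take the multiplier \<open>u\<^sub>q - \<Sum> \<eta>\<^sub>j u\<^sub>j = (f + e)(u) / d\<close>, so that its coefficient at
  \<open>u\<^sub>q\<close> is 1. With \<open>d\<^sub>1 = d / 2\<close> and \<open>d\<^sub>2 = 1 / (q d)\<close>, the identity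
  \<open>2 (f + e)(f - g) = (f + e - g)\<^sup>2 + f\<^sup>2 - e\<^sup>2 - g\<^sup>2\<close> turns the first claim into
  \<open>G(u) - G(u') = (f(u)\<^sup>2 - e(u)\<^sup>2 - g(u')\<^sup>2) / (2 d)\<close>. The right-hand side has this form
  as soon as \<open>e\<close>, \<open>g\<close>, \<open>f\<close> satisfy \<open>|e|\<^sup>2 + |g|\<^sup>2 = |f|\<^sup>2\<close> as trigonometric
  polynomials on the unit circle, that is, as soon as their autocorrelations match. Hence \<open>e\<close> is a
  spectral factor of the known function \<open>|f|\<^sup>2 - |g|\<^sup>2\<close>. Since
  \<open>f\<close> and \<open>g\<close> have the same value at \<open>\<zeta> = 1\<close>, it contains the factor \<open>\<zeta> - 1\<close>, and
  for \<open>q \<le> 4\<close> what remains, up to a power of \<open>\<zeta>\<close>, is a polynomial of degree at most 2, given by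
  square roots. The
  existence of \<open>G\<close> and its explicit form rest on \<open>tail_gram_telescope\<close>:
  for every \<open>c\<close> there is a sum of squares \<open>A\<^sub>c\<close> in \<open>q - 1\<close> variables such that
  \<open>A\<^sub>c(u\<^sub>2, \<dots>, u\<^sub>q) - A\<^sub>c(u\<^sub>1, \<dots>, u\<^bsub>q-1\<^esub>) + c(u)\<^sup>2\<close> depends only on the
  autocorrelations of \<open>c\<close> and is a multiple of \<open>u\<^sub>q\<close>. With \<open>K = A\<^sub>e + A\<^sub>g - A\<^sub>f\<close> this gives
  \<open>2 d G(u) = K(u\<^sub>2, \<dots>, u\<^sub>q) + g(u\<^sub>1, \<dots>, u\<^sub>q)\<^sup>2\<close>, which is positive
  definite if \<open>K\<close> is, because \<open>g\<^sub>1 \<noteq> 0\<close>.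

  The second claim is the telescoping identity itself, for a form \<open>c\<close> whose autocorrelations are prescribed
  by the coefficients of the multiplier. Such a \<open>c\<close> is a spectral factor of
  \<open>1 - \<Sum> \<eta>\<^sub>j cos ((q - j) \<theta>)\<close>, and \<open>A = A\<^sub>c\<close> is semidefinite because it is a sum of
  squares.

  For each order there remain a spectral factor \<open>e\<close>, the positivity of \<open>K\<close>, and the existence of
  \<open>c\<close>. The last is a Fejer-Riesz factorization of a cosine polynomial of degree at most 3, which
  is reduced to linear and quadratic factors.
\<close>

section \<open>Real linear and quadratic forms\<close>

definition lin :: "nat \<Rightarrow> (nat \<Rightarrow> real) \<Rightarrow> (nat \<Rightarrow> real) \<Rightarrow> real" where
  "lin n c x = (\<Sum>i=1..n. c i * x i)"

definition quad :: "nat \<Rightarrow> (nat \<Rightarrow> nat \<Rightarrow> real) \<Rightarrow> (nat \<Rightarrow> real) \<Rightarrow> real" where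
  "quad n m x = (\<Sum>i=1..n. \<Sum>j=1..n. m i j * x i * x j)"

text \<open>
  The cross terms between real and imaginary parts cancel by symmetry of the matrix.
\<close>

lemma sesq_form_real:
  assumes "\<And>i j. m i j = m j i"
  shows "sesq_form n (\<lambda>i j. complex_of_real (m i j)) u =
    complex_of_real (quad n m (\<lambda>i. Re (u i)) + quad n m (\<lambda>i. Im (u i)))"
proof (rule complex_eqI)
  show "Re (sesq_form n (\<lambda>i j. complex_of_real (m i j)) u) =
    Re (complex_of_real (quad n m (\<lambda>i. Re (u i)) + quad n m (\<lambda>i. Im (u i))))"
    by (simp add: sesq_form_def quad_def sum.distrib [symmetric] algebra_simps)
  define s where "s = (\<Sum>i=1..n. \<Sum>j=1..n. m i j * Im (u i) * Re (u j))"
  have "s = (\<Sum>i=1..n. \<Sum>j=1..n. m i j * Re (u i) * Im (u j))"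
    unfolding s_def
    by (subst sum.swap, intro sum.cong refl) (metis assms mult.assoc mult.commute)
  then show "Im (sesq_form n (\<lambda>i j. complex_of_real (m i j)) u) =
    Im (complex_of_real (quad n m (\<lambda>i. Re (u i)) + quad n m (\<lambda>i. Im (u i))))"
    by (simp add: sesq_form_def s_def sum_subtractf sum.distrib algebra_simps)
qed

section \<open>Sums of squares that telescope under a shift\<close>

text \<open>
  The autocorrelations of \<open>c\<close>: on \<open>|\<zeta>| = 1\<close>, the square \<open>|\<Sum> c\<^sub>i \<zeta>\<^sup>i|\<^sup>2\<close> is
  \<open>r\<^sub>0 + 2 \<Sum> r\<^sub>l cos (l \<theta>)\<close> with \<open>r\<^sub>l\<close> the value at \<open>l\<close>.
\<close>

definition corr :: "nat \<Rightarrow> (nat \<Rightarrow> real) \<Rightarrow> nat \<Rightarrow> real" where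
  "corr n c l = (\<Sum>i=1..n-l. c i * c (i + l))"

text \<open>
  The matrix of the sum of the squares of the tails of \<open>c\<close>, defined next. The entries do not
  involve the number of variables, so one matrix serves for all of them.
\<close>

definition tail_gram :: "(nat \<Rightarrow> real) \<Rightarrow> nat \<Rightarrow> nat \<Rightarrow> real" where
  "tail_gram c i j = (\<Sum>k<min i j. c (i - k) * c (j - k))"

text \<open>
  The value of the form \<open>c\<close> on \<open>x\<close> after \<open>k\<close> shifts, when the sequence is continued by zero
  beyond \<open>x\<^sub>n\<close>. If the difference of a form \<open>A\<close> under a shift, plus the square of \<open>c(x)\<close>, is a
  multiple of the newest entry, then feeding in zeros forces \<open>A\<close> to be the sum of the squares of
  these tails.
\<close>

definition tail :: "nat \<Rightarrow> (nat \<Rightarrow> real) \<Rightarrow> (nat \<Rightarrow> real) \<Rightarrow> nat \<Rightarrow> real" where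
  "tail n c x k = (\<Sum>i=Suc k..n. c (i - k) * x i)"

lemma tail_gram_sym: "tail_gram c i j = tail_gram c j i"
  by (simp add: tail_gram_def min.commute mult.commute)

lemma quad_tail_gram: "quad n (tail_gram c) x = (\<Sum>k<n. (tail n c x k)\<^sup>2)"
proof -
  let ?b = "\<lambda>i k. if k < i then c (i - k) else 0"
  have tail_eq: "tail n c x k = (\<Sum>i=1..n. ?b i k * x i)" for k
    unfolding tail_def by (rule sum.mono_neutral_cong_left) auto
  have gram_eq: "tail_gram c i j = (\<Sum>k<n. ?b i k * ?b j k)"
    if "i \<in> {1..n}" "j \<in> {1..n}" for i j
    unfolding tail_gram_def by (rule sum.mono_neutral_cong_left) (use that in auto)
  have "quad n (tail_gram c) x
      = (\<Sum>i=1..n. \<Sum>j=1..n. \<Sum>k<n. (?b i k * x i) * (?b j k * x j))"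
    unfolding quad_def
    by (intro sum.cong refl) (simp add: gram_eq sum_distrib_left sum_distrib_right mult_ac)
  also have "\<dots> = (\<Sum>i=1..n. \<Sum>k<n. \<Sum>j=1..n. (?b i k * x i) * (?b j k * x j))"
    by (intro sum.cong refl sum.swap)
  also have "\<dots> = (\<Sum>k<n. \<Sum>i=1..n. \<Sum>j=1..n. (?b i k * x i) * (?b j k * x j))"
    by (rule sum.swap)
  also have "\<dots> = (\<Sum>k<n. (tail n c x k)\<^sup>2)"
    by (simp only: tail_eq power2_eq_square sum_product)
  finally show ?thesis .
qed

text \<open>
  The tails of \<open>x\<^sub>2, \<dots>, x\<^sub>n\<close> are those of \<open>x\<^sub>1, \<dots>, x\<^sub>n\<close> with the index moved by one,
  and the tails of \<open>x\<^sub>1, \<dots>, x\<^bsub>n-1\<^esub>\<close> lack only their last summand. So the squares cancel except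
  for products with \<open>x\<^sub>n\<close>, and the coefficients of these products collect into autocorrelations.
\<close>

lemma tail_gram_telescope:
  assumes "n \<ge> 1"
  shows "quad (n - 1) (tail_gram c) (\<lambda>i. x (i + 1)) - quad (n - 1) (tail_gram c) x
      + (lin n c x)\<^sup>2 = x n * (corr n c 0 * x n + 2 * (\<Sum>l=1..n-1. corr n c l * x (n - l)))"
proof -
  obtain m where n: "n = Suc m"
    using assms by (cases n) auto
  let ?S = "tail n c x"
  have shifted: "tail m c (\<lambda>i. x (i + 1)) k = ?S (Suc k)" for k
  proof -
    have "?S (Suc k) = (\<Sum>i=Suc (Suc k)..Suc m. c (i - Suc k) * x i)"
      by (simp add: tail_def n)
    also have "\<dots> = (\<Sum>i=Suc k..m. c (Suc i - Suc k) * x (Suc i))"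
      by (rule sum.shift_bounds_cl_Suc_ivl)
    finally show ?thesis by (simp add: tail_def)
  qed
  have truncated: "tail m c x k = ?S k - c (n - k) * x n" if "k < n" for k
    using that by (simp add: tail_def n)
  have head: "?S 0 = lin n c x"
    by (simp add: tail_def lin_def)
  have "quad m (tail_gram c) (\<lambda>i. x (i + 1)) + (lin n c x)\<^sup>2 = (\<Sum>k<n. (?S k)\<^sup>2)"
    unfolding quad_tail_gram shifted n sum.lessThan_Suc_shift using head n by simp
  moreover have "quad m (tail_gram c) x = (\<Sum>k<n. (?S k - c (n - k) * x n)\<^sup>2)"
    using truncated by (simp add: quad_tail_gram n tail_def)
  ultimately have "quad m (tail_gram c) (\<lambda>i. x (i + 1)) - quad m (tail_gram c) x + (lin n c x)\<^sup>2
      = (\<Sum>k<n. (?S k)\<^sup>2 - (?S k - c (n - k) * x n)\<^sup>2)"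
    by (simp add: sum_subtractf)
  also have "\<dots> = x n * (2 * (\<Sum>k<n. c (n - k) * ?S k) - (\<Sum>k<n. (c (n - k))\<^sup>2) * x n)"
    by (simp add: power2_eq_square algebra_simps sum_distrib_left sum_subtractf sum.distrib)
  also have "(\<Sum>k<n. c (n - k) * ?S k) = (\<Sum>l<n. corr n c l * x (n - l))"
  proof -
    have "(\<Sum>k<n. c (n - k) * ?S k)
        = (\<Sum>k<n. \<Sum>i=1..n. if k < i then c (n - k) * (c (i - k) * x i) else 0)"
      unfolding tail_def sum_distrib_left
      by (intro sum.cong refl sum.mono_neutral_cong_left) auto
    also have "\<dots> = (\<Sum>i=1..n. \<Sum>k<n. if k < i then c (n - k) * (c (i - k) * x i) else 0)"
      by (rule sum.swap)
    also have "\<dots> = (\<Sum>i=1..n. corr n c (n - i) * x i)"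
    proof (intro sum.cong refl)
      fix i assume i: "i \<in> {1..n}"
      have "(\<Sum>k<n. if k < i then c (n - k) * (c (i - k) * x i) else 0)
          = (\<Sum>k<i. c (n - k) * (c (i - k) * x i))"
        by (rule sum.mono_neutral_cong_right) (use i in auto)
      also have "\<dots> = (\<Sum>j=1..i. c j * c (j + (n - i)) * x i)"
        by (rule sum.reindex_bij_witness [where i = "\<lambda>j. i - j" and j = "\<lambda>k. i - k"])
           (use i in \<open>auto simp: mult_ac\<close>)
      finally show "(\<Sum>k<n. if k < i then c (n - k) * (c (i - k) * x i) else 0)
          = corr n c (n - i) * x i"
        using i by (simp add: corr_def sum_distrib_right)
    qed
    also have "\<dots> = (\<Sum>l<n. corr n c l * x (n - l))"
      by (rule sum.reindex_bij_witness [where i = "\<lambda>j. n - j" and j = "\<lambda>k. n - k"]) auto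
    finally show ?thesis .
  qed
  also have "(\<Sum>k<n. (c (n - k))\<^sup>2) = corr n c 0"
    unfolding corr_def power2_eq_square
    by (rule sum.reindex_bij_witness [where i = "\<lambda>j. n - j" and j = "\<lambda>k. n - k"]) auto
  also have "(\<Sum>l<n. corr n c l * x (n - l))
      = corr n c 0 * x n + (\<Sum>l=1..n-1. corr n c l * x (n - l))"
    unfolding n by (simp add: sum.lessThan_Suc_shift sum.atLeast1_atMost_eq del: sum.lessThan_Suc)
  finally show ?thesis
    by (simp add: n algebra_simps)
qed

lemma quad_tail_gram_nonneg: "quad n (tail_gram c) x \<ge> 0"
  by (simp add: quad_tail_gram sum_nonneg)

lemma quad_scale: "quad n (\<lambda>i j. m i j / d) x = quad n m x / d"
  by (simp add: quad_def sum_divide_distrib)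

text \<open>
  The matrix of \<open>m(x\<^sub>2, \<dots>, x\<^sub>n) + g(x\<^sub>1, \<dots>, x\<^sub>n)\<^sup>2\<close>.
\<close>

definition extend_form :: "(nat \<Rightarrow> nat \<Rightarrow> real) \<Rightarrow> (nat \<Rightarrow> real) \<Rightarrow> nat \<Rightarrow> nat \<Rightarrow> real" where
  "extend_form m g i j = (if 2 \<le> i \<and> 2 \<le> j then m (i - 1) (j - 1) else 0) + g i * g j"

lemma quad_extend_form:
  assumes "n \<ge> 1"
  shows "quad n (extend_form m g) x = quad (n - 1) m (\<lambda>i. x (i + 1)) + (lin n g x)\<^sup>2"
proof -
  have tl: "(\<Sum>i=1..n. if 2 \<le> i then h i else 0) = (\<Sum>i=1..n-1. h (i + 1))" for h :: "nat \<Rightarrow> real"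
  proof -
    have "(\<Sum>i=1..n. if 2 \<le> i then h i else 0) = (\<Sum>i=2..n. h i)"
      by (rule sum.mono_neutral_cong_right) auto
    also have "\<dots> = (\<Sum>i=1..n-1. h (i + 1))"
      by (rule sum.reindex_bij_witness [where i = "\<lambda>i. i + 1" and j = "\<lambda>i. i - 1"]) auto
    finally show ?thesis .
  qed
  have "quad n (extend_form m g) x
      = (\<Sum>i=1..n. if 2 \<le> i then
            (\<Sum>j=1..n. if 2 \<le> j then m (i - 1) (j - 1) * x i * x j else 0) else 0)
        + (\<Sum>i=1..n. \<Sum>j=1..n. (g i * x i) * (g j * x j))"
    unfolding quad_def extend_form_def sum.distrib [symmetric]
    by (intro sum.cong refl) (auto simp: sum.distrib [symmetric] algebra_simps intro!: sum.cong)
  then show ?thesis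
    unfolding tl by (simp add: quad_def lin_def power2_eq_square sum_product)
qed

text \<open>
  If \<open>x\<^sub>2, \<dots>, x\<^sub>n\<close> all vanish, the square reduces to \<open>(g\<^sub>1 x\<^sub>1)\<^sup>2\<close>.
\<close>

lemma quad_extend_form_pos:
  assumes "n \<ge> 1" and "g 1 \<noteq> 0"
    and pos: "\<And>y. (\<exists>i\<in>{1..n-1}. y i \<noteq> 0) \<Longrightarrow> quad (n - 1) m y > 0"
    and "\<exists>i\<in>{1..n}. x i \<noteq> 0"
  shows "quad n (extend_form m g) x > 0"
proof (cases "\<exists>i\<in>{1..n-1}. x (i + 1) \<noteq> 0")
  case True
  then have "quad (n - 1) m (\<lambda>i. x (i + 1)) > 0"
    by (rule pos)
  then show ?thesis
    by (simp add: quad_extend_form [OF \<open>n \<ge> 1\<close>] add_pos_nonneg)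
next
  case False
  have zero: "x i = 0" if "i \<in> {1..n} - {1}" for i
  proof -
    have "i - 1 \<in> {1..n-1}" "i - 1 + 1 = i"
      using that by auto
    then show ?thesis
      using False by metis
  qed
  then have "x 1 \<noteq> 0"
    using assms(4) by (metis DiffI singletonD)
  have "lin n g x = (\<Sum>i\<in>{1}. g i * x i)"
    unfolding lin_def by (rule sum.mono_neutral_right) (use zero \<open>n \<ge> 1\<close> in auto)
  then have "lin n g x \<noteq> 0"
    using \<open>x 1 \<noteq> 0\<close> \<open>g 1 \<noteq> 0\<close> by simp
  moreover have "quad (n - 1) m (\<lambda>i. x (i + 1)) = 0"
    using False by (auto simp: quad_def intro!: sum.neutral)
  ultimately show ?thesis
    by (simp add: quad_extend_form [OF \<open>n \<ge> 1\<close>])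
qed

text \<open>
  A shift identity for any three forms whose squared moduli on the unit circle satisfy
  \<open>|e|\<^sup>2 + |g|\<^sup>2 = |f|\<^sup>2\<close>: the three right-hand sides of \<open>tail_gram_telescope\<close> cancel.
\<close>

lemma balanced_telescope:
  assumes "n \<ge> 1" and corr: "\<And>l. l < n \<Longrightarrow> corr n e l + corr n g l = corr n f l"
  defines "m \<equiv> \<lambda>i j. tail_gram e i j + tail_gram g i j - tail_gram f i j"
  shows "quad (n - 1) m (\<lambda>i. x (i + 1)) + (lin n g x)\<^sup>2
    = quad (n - 1) m x + (lin n f x)\<^sup>2 - (lin n e x)\<^sup>2"
proof -
  have m: "quad k m y = quad k (tail_gram e) y + quad k (tail_gram g) y - quad k (tail_gram f) y" for k y
    by (simp add: quad_def m_def sum.distrib sum_subtractf algebra_simps)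
  let ?R = "\<lambda>c. x n * (corr n c 0 * x n + 2 * (\<Sum>l=1..n-1. corr n c l * x (n - l)))"
  have "(\<Sum>l=1..n-1. corr n f l * x (n - l))
      = (\<Sum>l=1..n-1. (corr n e l + corr n g l) * x (n - l))"
    by (intro sum.cong refl) (use corr \<open>n \<ge> 1\<close> in auto)
  moreover have "corr n f 0 = corr n e 0 + corr n g 0"
    using corr [of 0] \<open>n \<ge> 1\<close> by simp
  ultimately have "?R f = ?R e + ?R g"
    by (simp add: algebra_simps sum.distrib)
  then show ?thesis
    unfolding m using tail_gram_telescope [OF \<open>n \<ge> 1\<close>, of e x]
      tail_gram_telescope [OF \<open>n \<ge> 1\<close>, of f x] tail_gram_telescope [OF \<open>n \<ge> 1\<close>, of g x]
    by linarith
qed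

section \<open>The energy identities from a spectral factor\<close>

definition has_energy_identities :: "nat \<Rightarrow> bool" where
  "has_energy_identities q \<longleftrightarrow> (\<exists>(g :: nat \<Rightarrow> nat \<Rightarrow> real) (a :: nat \<Rightarrow> nat \<Rightarrow> real)
           (\<eta> :: nat \<Rightarrow> real) (c :: nat \<Rightarrow> real) (d1 :: real) (d2 :: real).
      pos_def_hermitian q (\<lambda>i j. complex_of_real (g i j)) \<and>
      pos_semidef_hermitian (q - 1) (\<lambda>i j. complex_of_real (a i j)) \<and>
      d1 > 0 \<and>
      (\<forall>u :: nat \<Rightarrow> complex.
        complex_of_real (Re ((cnj (u q) - (\<Sum>j=1..q-1. complex_of_real (\<eta> j) * cnj (u j))) *
                             (\<Sum>i=0..q. complex_of_real (bdf_alpha q i) * u i)))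
        = sesq_form q (\<lambda>i j. complex_of_real (g i j)) u
          - sesq_form q (\<lambda>i j. complex_of_real (g i j)) (\<lambda>i. u (i - 1))
          + complex_of_real (d1 * (cmod (u q - (\<Sum>i=1..q-1. complex_of_real (\<eta> i) * u i)
              - complex_of_real d2 * (\<Sum>i=0..q-1. complex_of_real (bdf_gamma q i) * u i)))\<^sup>2)
        \<and>
        complex_of_real (Re ((cnj (u q) - (\<Sum>i=1..q-1. complex_of_real (\<eta> i) * cnj (u i))) * u q))
        = sesq_form (q - 1) (\<lambda>i j. complex_of_real (a i j)) (\<lambda>i. u (i + 1))
          - sesq_form (q - 1) (\<lambda>i j. complex_of_real (a i j)) u
          + complex_of_real ((cmod (\<Sum>i=1..q. complex_of_real (c i) * u i))\<^sup>2)))"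

text \<open>
  The construction for a general order. The hypotheses \<open>corr\<close>, \<open>c0\<close> and \<open>cl\<close> say that \<open>e\<close>
  and \<open>c\<close> are spectral factors; \<open>c\<close> belongs to the multiplier scaled by \<open>d\<close>, whose coefficients are
  affine in \<open>e\<close>, and is divided by \<open>sqrt d\<close> in the end.
\<close>

lemma energy_identities:
  fixes e f g c :: "nat \<Rightarrow> real" and q :: nat
  assumes q: "q \<ge> 1"
    and alpha: "\<And>i. i \<le> q \<Longrightarrow>
      bdf_alpha q i = (if i = 0 then 0 else f i) - (if i = q then 0 else g (i + 1))"
    and gamma: "\<And>i. i < q \<Longrightarrow> bdf_gamma q i = q * g (i + 1)"
    and corr: "\<And>l. l < q \<Longrightarrow> corr q e l + corr q g l = corr q f l"
    and g1: "g 1 \<noteq> 0" and lead: "f q + e q > 0"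
    and pos: "\<And>y. (\<exists>i\<in>{1..q-1}. y i \<noteq> 0) \<Longrightarrow>
      quad (q - 1) (\<lambda>i j. tail_gram e i j + tail_gram g i j - tail_gram f i j) y > 0"
    and c0: "corr q c 0 = f q + e q"
    and cl: "\<And>l. 1 \<le> l \<Longrightarrow> l < q \<Longrightarrow> 2 * corr q c l = f (q - l) + e (q - l)"
  shows "has_energy_identities q"
proof -
  define d where "d = f q + e q"
  define k where "k = (\<lambda>i j. tail_gram e i j + tail_gram g i j - tail_gram f i j)"
  define G where "G = (\<lambda>i j. extend_form k g i j / (2 * d))"
  define A where "A = (\<lambda>i j. tail_gram c i j / d)"
  define \<eta> where "\<eta> = (\<lambda>i. - (f i + e i) / d)"
  define c' where "c' = (\<lambda>i. c i / sqrt d)"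
  have d: "d > 0"
    using lead by (simp add: d_def)
  have k_sym: "k i j = k j i" for i j
    using tail_gram_sym unfolding k_def by metis
  have G_sym: "G i j = G j i" for i j
    using k_sym unfolding G_def extend_form_def by auto
  have A_sym: "A i j = A j i" for i j
    using tail_gram_sym unfolding A_def by metis

  \<comment> \<open>The multiplier and the implicit and explicit parts of the scheme, on real sequences.\<close>
  define P where "P = (\<lambda>x. x q - (\<Sum>i=1..q-1. \<eta> i * x i))"
  define F where "F = (\<lambda>x. \<Sum>i=0..q. bdf_alpha q i * x i)"
  define \<Gamma> where "\<Gamma> = (\<lambda>x. \<Sum>i=0..q-1. bdf_gamma q i * x i)"
  have P_scaled: "P x = (d * x q + (\<Sum>i=1..q-1. (f i + e i) * x i)) / d" for x
  proof -
    have "(\<Sum>i=1..q-1. \<eta> i * x i) = - ((\<Sum>i=1..q-1. (f i + e i) * x i) / d)"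
      unfolding \<eta>_def sum_divide_distrib sum_negf [symmetric]
      using d by (intro sum.cong refl) (simp add: field_simps)
    then show ?thesis
      using d by (simp add: P_def add_divide_distrib)
  qed
  have mult: "P x = (lin q f x + lin q e x) / d" for x
  proof -
    obtain m where m: "q = Suc m"
      using q by (cases q) auto
    have "lin q f x + lin q e x = (\<Sum>i=1..q-1. (f i + e i) * x i) + d * x q"
      by (simp add: m lin_def d_def sum.distrib algebra_simps)
    then show ?thesis
      by (simp only: P_scaled add.commute)
  qed
  have alpha_lin: "F x = lin q f x - lin q g (\<lambda>i. x (i - 1))" for x
  proof -
    have "F x = (\<Sum>i=0..q. (if i = 0 then 0 else f i) * x i)
        - (\<Sum>i=0..q. (if i = q then 0 else g (i + 1)) * x i)"
      by (simp add: F_def alpha left_diff_distrib sum_subtractf)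
    moreover have "(\<Sum>i=0..q. (if i = 0 then 0 else f i) * x i) = lin q f x"
      unfolding lin_def by (rule sum.mono_neutral_cong_right) auto
    moreover have "(\<Sum>i=0..q. (if i = q then 0 else g (i + 1)) * x i)
        = (\<Sum>i<q. g (i + 1) * x i)"
      by (rule sum.mono_neutral_cong_right) auto
    moreover have "\<dots> = lin q g (\<lambda>i. x (i - 1))"
      unfolding lin_def
      by (rule sum.reindex_bij_witness [where i = "\<lambda>i. i - 1" and j = "\<lambda>i. i + 1"]) auto
    ultimately show ?thesis by simp
  qed
  have gamma_lin: "\<Gamma> x = q * lin q g (\<lambda>i. x (i - 1))" for x
  proof -
    have "\<Gamma> x = (\<Sum>i<q. q * (g (i + 1) * x i))"
      unfolding \<Gamma>_def by (rule sum.cong) (use q gamma in auto)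
    also have "\<dots> = (\<Sum>i=1..q. q * (g i * x (i - 1)))"
      by (rule sum.reindex_bij_witness [where i = "\<lambda>i. i - 1" and j = "\<lambda>i. i + 1"]) auto
    finally show ?thesis
      by (simp add: lin_def sum_distrib_left)
  qed

  have G_quad: "quad q G x = (quad (q - 1) k (\<lambda>i. x (i + 1)) + (lin q g x)\<^sup>2) / (2 * d)" for x
    unfolding G_def quad_scale quad_extend_form [OF q] ..
  have first: "P x * F x = quad q G x - quad q G (\<lambda>i. x (i - 1))
      + d / 2 * (P x - 1 / (q * d) * \<Gamma> x)\<^sup>2" for x
  proof -
    let ?e = "lin q e x" and ?f = "lin q f x" and ?g = "lin q g (\<lambda>i. x (i - 1))"
    have "quad (q - 1) k (\<lambda>i. x (i + 1)) + (lin q g x)\<^sup>2 = quad (q - 1) k x + ?f\<^sup>2 - ?e\<^sup>2"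
      unfolding k_def by (rule balanced_telescope [OF q corr])
    then have "quad q G x - quad q G (\<lambda>i. x (i - 1)) = (?f\<^sup>2 - ?e\<^sup>2 - ?g\<^sup>2) / (2 * d)"
      by (simp add: G_quad diff_divide_distrib [symmetric])
    moreover have "P x - 1 / (q * d) * \<Gamma> x = (?f + ?e - ?g) / d"
      using d q by (simp add: mult gamma_lin diff_divide_distrib)
    \<comment> \<open>The second factor is the scheme; the square on the right is the dissipation term.\<close>
    moreover have "(?f + ?e) / d * (?f - ?g)
        = (?f\<^sup>2 - ?e\<^sup>2 - ?g\<^sup>2) / (2 * d) + d / 2 * ((?f + ?e - ?g) / d)\<^sup>2"
      using d by (simp add: field_simps power2_eq_square)
    ultimately show ?thesis
      by (simp only: mult alpha_lin)
  qed
  have A_quad: "quad (q - 1) A x = quad (q - 1) (tail_gram c) x / d" for x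
    unfolding A_def quad_scale ..
  have second: "P x * x q = quad (q - 1) A (\<lambda>i. x (i + 1)) - quad (q - 1) A x
      + (lin q c' x)\<^sup>2" for x
  proof -
    have "lin q c' x = lin q c x / sqrt d"
      by (simp add: lin_def c'_def sum_divide_distrib)
    then have "(lin q c' x)\<^sup>2 = (lin q c x)\<^sup>2 / d"
      using d by (simp add: power_divide)
    then have "quad (q - 1) A (\<lambda>i. x (i + 1)) - quad (q - 1) A x + (lin q c' x)\<^sup>2
        = x q * (corr q c 0 * x q + 2 * (\<Sum>l=1..q-1. corr q c l * x (q - l))) / d"
      unfolding tail_gram_telescope [OF q, of c x, symmetric] A_quad
      by (simp only: diff_divide_distrib add_divide_distrib)
    also have "2 * (\<Sum>l=1..q-1. corr q c l * x (q - l))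
        = (\<Sum>l=1..q-1. (f (q - l) + e (q - l)) * x (q - l))"
      unfolding sum_distrib_left by (intro sum.cong refl) (use cl in auto)
    also have "\<dots> = (\<Sum>i=1..q-1. (f i + e i) * x i)"
      by (rule sum.reindex_bij_witness [where i = "\<lambda>l. q - l" and j = "\<lambda>l. q - l"]) auto
    finally show ?thesis
      by (simp add: P_scaled c0 d_def [symmetric] mult.commute)
  qed

  let ?re = "\<lambda>u i. Re (u i)" and ?im = "\<lambda>u i. Im (u i)"
  have P_complex: "u q - (\<Sum>i=1..q-1. complex_of_real (\<eta> i) * u i) = Complex (P (?re u)) (P (?im u))" for u
    by (rule complex_eqI) (simp_all add: P_def)
  have P_cnj: "cnj (u q) - (\<Sum>i=1..q-1. complex_of_real (\<eta> i) * cnj (u i))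
      = cnj (Complex (P (?re u)) (P (?im u)))" for u
    by (rule complex_eqI) (simp_all add: P_def sum_negf)
  have F_complex: "(\<Sum>i=0..q. complex_of_real (bdf_alpha q i) * u i)
      = Complex (F (?re u)) (F (?im u))" for u
    by (rule complex_eqI) (simp_all add: F_def)
  have \<Gamma>_complex: "(\<Sum>i=0..q-1. complex_of_real (bdf_gamma q i) * u i)
      = Complex (\<Gamma> (?re u)) (\<Gamma> (?im u))" for u
    by (rule complex_eqI) (simp_all add: \<Gamma>_def)
  have c_complex: "(\<Sum>i=1..q. complex_of_real (c' i) * u i)
      = Complex (lin q c' (?re u)) (lin q c' (?im u))" for u
    by (rule complex_eqI) (simp_all add: lin_def)

  have G_pos: "pos_def_hermitian q (\<lambda>i j. complex_of_real (G i j))"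
  proof -
    have G_pos_real: "quad q G x > 0" if "\<exists>i\<in>{1..q}. x i \<noteq> 0" for x
      unfolding G_def quad_scale
      using quad_extend_form_pos [where m = k and g = g, OF q g1 _ that] pos d by (simp add: k_def)
    have G_nonneg: "quad q G x \<ge> 0" for x
      using G_pos_real [of x] by (cases "\<exists>i\<in>{1..q}. x i \<noteq> 0") (auto simp: quad_def)
    have "Re (sesq_form q (\<lambda>i j. complex_of_real (G i j)) u) > 0"
      if u: "\<exists>i\<in>{1..q}. u i \<noteq> 0" for u
    proof -
      have "(\<exists>i\<in>{1..q}. Re (u i) \<noteq> 0) \<or> (\<exists>i\<in>{1..q}. Im (u i) \<noteq> 0)"
        using u by (metis complex_eqI zero_complex.sel)
      then show ?thesis
        using G_pos_real [of "?re u"] G_pos_real [of "?im u"] G_nonneg [of "?re u"] G_nonneg [of "?im u"]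
        by (auto simp: sesq_form_real [of G, OF G_sym] intro: add_pos_nonneg add_nonneg_pos)
    qed
    then show ?thesis
      using G_sym by (simp add: pos_def_hermitian_def hermitian_form_def)
  qed
  have A_pos: "pos_semidef_hermitian (q - 1) (\<lambda>i j. complex_of_real (A i j))"
    using A_sym d quad_tail_gram_nonneg
    by (simp add: pos_semidef_hermitian_def hermitian_form_def sesq_form_real [of A, OF A_sym]
        A_quad del: One_nat_def)
  have id1: "complex_of_real (Re ((cnj (u q) - (\<Sum>j=1..q-1. complex_of_real (\<eta> j) * cnj (u j))) *
                             (\<Sum>i=0..q. complex_of_real (bdf_alpha q i) * u i)))
        = sesq_form q (\<lambda>i j. complex_of_real (G i j)) u
          - sesq_form q (\<lambda>i j. complex_of_real (G i j)) (\<lambda>i. u (i - 1))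
          + complex_of_real (d / 2 * (cmod (u q - (\<Sum>i=1..q-1. complex_of_real (\<eta> i) * u i)
              - complex_of_real (1 / (q * d)) * (\<Sum>i=0..q-1. complex_of_real (bdf_gamma q i) * u i)))\<^sup>2)"
    for u
    using first [of "?re u"] first [of "?im u"]
    unfolding P_complex P_cnj F_complex \<Gamma>_complex sesq_form_real [of G, OF G_sym]
      of_real_add [symmetric] of_real_diff [symmetric] of_real_eq_iff cmod_power2
    by (simp add: algebra_simps)
  have id2: "complex_of_real (Re ((cnj (u q) - (\<Sum>i=1..q-1. complex_of_real (\<eta> i) * cnj (u i))) * u q))
        = sesq_form (q - 1) (\<lambda>i j. complex_of_real (A i j)) (\<lambda>i. u (i + 1))
          - sesq_form (q - 1) (\<lambda>i j. complex_of_real (A i j)) u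
          + complex_of_real ((cmod (\<Sum>i=1..q. complex_of_real (c' i) * u i))\<^sup>2)" for u
    using second [of "?re u"] second [of "?im u"]
    unfolding P_cnj c_complex sesq_form_real [of A, OF A_sym]
      of_real_add [symmetric] of_real_diff [symmetric] of_real_eq_iff cmod_power2
    by (simp add: algebra_simps)
  have "d / 2 > 0"
    using d by simp
  with G_pos A_pos id1 id2 show ?thesis
    unfolding has_energy_identities_def
    by (intro exI [of _ G] exI [of _ A] exI [of _ \<eta>] exI [of _ c'] exI [of _ "d / 2"]
        exI [of _ "1 / (q * d)"] conjI allI)
qed

section \<open>Coefficients of the schemes\<close>

lemma bdf_coeffs_1: "bdf_alpha_poly 1 = [:-1, 1:]" "bdf_gamma_poly 1 = [:1:]"
  by (simp_all add: bdf_alpha_poly_def bdf_gamma_poly_def bdf_beta_def numeral_eq_Suc monom_Suc monom_0)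

lemma bdf_coeffs_2:
  "bdf_alpha_poly 2 = [:1/3, -4/3, 1:]"
  "bdf_gamma_poly 2 = [:-2/3, 4/3:]"
  by (simp_all add: bdf_alpha_poly_def bdf_gamma_poly_def bdf_beta_def numeral_eq_Suc monom_Suc monom_0)

lemma bdf_coeffs_3:
  "bdf_alpha_poly 3 = [:-2/11, 9/11, -18/11, 1:]"
  "bdf_gamma_poly 3 = [:6/11, -18/11, 18/11:]"
  by (simp_all add: bdf_alpha_poly_def bdf_gamma_poly_def bdf_beta_def numeral_eq_Suc monom_Suc monom_0)

lemma bdf_coeffs_4:
  "bdf_alpha_poly 4 = [:3/25, -16/25, 36/25, -48/25, 1:]"
  "bdf_gamma_poly 4 = [:-12/25, 48/25, -72/25, 48/25:]"
  by (simp_all add: bdf_alpha_poly_def bdf_gamma_poly_def bdf_beta_def numeral_eq_Suc monom_Suc monom_0)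

text \<open>
  Vectors are indexed from 1, lists from 0.
\<close>

definition vec :: "real list \<Rightarrow> nat \<Rightarrow> real" where
  "vec xs i = xs ! (i - 1)"

lemma vec_simps:
  "vec (x # xs) (Suc 0) = x" "vec (x # xs) (Suc (Suc i)) = vec xs (Suc i)"
  by (simp_all add: vec_def)

lemma corr_expand:
  "corr 3 c 0 = c 1 * c 1 + c 2 * c 2 + c 3 * c 3"
  "corr 3 c 1 = c 1 * c 2 + c 2 * c 3"
  "corr 3 c 2 = c 1 * c 3"
  "corr 4 c 0 = c 1 * c 1 + c 2 * c 2 + c 3 * c 3 + c 4 * c 4"
  "corr 4 c 1 = c 1 * c 2 + c 2 * c 3 + c 3 * c 4"
  "corr 4 c 2 = c 1 * c 3 + c 2 * c 4"
  "corr 4 c 3 = c 1 * c 4"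
  by (simp_all add: corr_def numeral_eq_Suc)

section \<open>Fejer-Riesz factors of cosine polynomials\<close>

text \<open>
  A factor \<open>c\<close> of \<open>T(\<theta>) = n\<^sub>0 + n\<^sub>1 cos \<theta> + n\<^sub>2 cos 2\<theta>\<close> must have
  \<open>c\<^sub>1 + c\<^sub>2 + c\<^sub>3\<close> and \<open>c\<^sub>1 - c\<^sub>2 + c\<^sub>3\<close> equal to square roots \<open>a\<close>, \<open>b\<close> of
  \<open>T(0)\<close> and \<open>T(\<pi>)\<close>. This fixes \<open>c\<^sub>2\<close> and the sum \<open>s\<close> of \<open>c\<^sub>1\<close> and \<open>c\<^sub>3\<close>, whose
  product is \<open>n\<^sub>2 / 2\<close>; they are real if \<open>2 n\<^sub>2 \<le> s\<^sup>2\<close>. The hypotheses ensure this: as a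
  polynomial in \<open>t = cos \<theta>\<close>, \<open>T\<close> is \<open>n\<^sub>0 - n\<^sub>2 + n\<^sub>1 t + 2 n\<^sub>2 t\<^sup>2\<close>, either concave or of
  nonpositive discriminant.
\<close>

lemma fejer_riesz_2:
  fixes n0 n1 n2 :: real
  assumes "n0 + n1 + n2 \<ge> 0" "n0 - n1 + n2 \<ge> 0"
    and "n2 \<le> 0 \<or> n1\<^sup>2 \<le> 8 * n2 * (n0 - n2)"
  obtains c1 c2 c3 :: real
  where "c1\<^sup>2 + c2\<^sup>2 + c3\<^sup>2 = n0" "2 * (c1 * c2 + c2 * c3) = n1" "2 * (c1 * c3) = n2"
proof -
  define a b where "a = sqrt (n0 + n1 + n2)" and "b = sqrt (n0 - n1 + n2)"
  define s where "s = (a + b) / 2"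
  have a2: "a\<^sup>2 = n0 + n1 + n2" and b2: "b\<^sup>2 = n0 - n1 + n2" and nn: "a \<ge> 0" "b \<ge> 0"
    using assms by (simp_all add: a_def b_def)
  have s2: "4 * s\<^sup>2 = 2 * n0 + 2 * n2 + 2 * (a * b)"
    using a2 b2 by (simp add: s_def power2_eq_square field_simps)
  have "2 * n2 \<le> s\<^sup>2"
  proof (cases "n2 \<le> 0")
    case True
    then show ?thesis
      by (meson mult_nonneg_nonpos order_trans zero_le_numeral zero_le_power2)
  next
    case False
    then have "(3 * n2 - n0)\<^sup>2 \<le> (n0 + n2)\<^sup>2 - n1\<^sup>2"
      using assms(3) by (simp add: power2_eq_square algebra_simps)
    also have "\<dots> = (a * b)\<^sup>2"
      unfolding power_mult_distrib a2 b2 by (simp add: power2_eq_square algebra_simps)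
    finally have "3 * n2 - n0 \<le> a * b"
      using nn by (meson mult_nonneg_nonneg power2_le_imp_le)
    then show ?thesis
      using s2 by linarith
  qed
  then have r2: "(sqrt (s\<^sup>2 - 2 * n2))\<^sup>2 = s\<^sup>2 - 2 * n2" (is "?r\<^sup>2 = _")
    by simp
  show ?thesis
  proof
    show "2 * ((s + ?r) / 2 * ((s - ?r) / 2)) = n2"
      using r2 by (simp add: power2_eq_square field_simps)
    show "2 * ((s + ?r) / 2 * ((a - b) / 2) + (a - b) / 2 * ((s - ?r) / 2)) = n1"
      using a2 b2 by (simp add: s_def power2_eq_square field_simps)
    have "((s + ?r) / 2)\<^sup>2 + ((a - b) / 2)\<^sup>2 + ((s - ?r) / 2)\<^sup>2 = (s\<^sup>2 + ?r\<^sup>2) / 2 + (a - b)\<^sup>2 / 4"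
      by (simp add: power2_eq_square field_simps)
    also have "\<dots> = s\<^sup>2 - n2 + (a\<^sup>2 + b\<^sup>2 - 2 * (a * b)) / 4"
      unfolding r2 by (simp add: power2_eq_square field_simps)
    also have "\<dots> = n0"
      unfolding a2 b2 using s2 by (simp add: field_simps)
    finally show "((s + ?r) / 2)\<^sup>2 + ((a - b) / 2)\<^sup>2 + ((s - ?r) / 2)\<^sup>2 = n0" .
  qed
qed

text \<open>
  In \<open>t = cos \<theta>\<close>, the cosine polynomial with coefficients \<open>n\<^sub>0, \<dots>, n\<^sub>3\<close> is a cubic, and
  \<open>factors\<close> says that it equals \<open>(y - t) (q\<^sub>0 + q\<^sub>1 t + q\<^sub>2 t\<^sup>2)\<close>. For \<open>y \<ge> 1\<close> the linear
  factor is \<open>|a - b \<zeta>|\<^sup>2\<close> with \<open>a\<^sup>2 + b\<^sup>2 = y\<close> and \<open>2 a b = 1\<close>, the quadratic one is treated by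
  \<open>fejer_riesz_2\<close>, and \<open>c\<close> is the product of the two polynomial factors.
\<close>

lemma fejer_riesz_3:
  fixes n0 n1 n2 n3 y q0 q1 q2 :: real
  assumes factors: "n0 - n2 = y * q0" "n1 - 3 * n3 = y * q1 - q0" "2 * n2 = y * q2 - q1"
      "4 * n3 = - q2"
    and y: "y \<ge> 1"
    and nonneg: "q0 + q1 + q2 \<ge> 0" "q0 - q1 + q2 \<ge> 0" "q2 \<le> 0 \<or> q1\<^sup>2 \<le> 4 * q0 * q2"
  obtains c1 c2 c3 c4 :: real
  where "c1\<^sup>2 + c2\<^sup>2 + c3\<^sup>2 + c4\<^sup>2 = n0" "2 * (c1 * c2 + c2 * c3 + c3 * c4) = n1"
    "2 * (c1 * c3 + c2 * c4) = n2" "2 * (c1 * c4) = n3"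
proof -
  define a b where "a = (sqrt (y + 1) + sqrt (y - 1)) / 2" and "b = (sqrt (y + 1) - sqrt (y - 1)) / 2"
  have ab: "2 * (a * b) = 1"
    using y by (simp add: a_def b_def field_simps)
  have y_eq: "a * a + b * b = y"
    using y by (simp add: a_def b_def field_simps)
  have "(q0 + q2 / 2) + q1 + q2 / 2 \<ge> 0" "(q0 + q2 / 2) - q1 + q2 / 2 \<ge> 0"
    "q2 / 2 \<le> 0 \<or> q1\<^sup>2 \<le> 8 * (q2 / 2) * ((q0 + q2 / 2) - q2 / 2)"
    using nonneg by (auto simp: algebra_simps)
  then obtain c1 c2 c3
    where c: "c1\<^sup>2 + c2\<^sup>2 + c3\<^sup>2 = q0 + q2 / 2" "2 * (c1 * c2 + c2 * c3) = q1" "2 * (c1 * c3) = q2 / 2"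
    by (rule fejer_riesz_2)
  show ?thesis
  proof
    have "(a * c1)\<^sup>2 + (a * c2 - b * c1)\<^sup>2 + (a * c3 - b * c2)\<^sup>2 + (- b * c3)\<^sup>2
        = (a * a + b * b) * (c1\<^sup>2 + c2\<^sup>2 + c3\<^sup>2) - (2 * (a * b)) * (c1 * c2 + c2 * c3)"
      by (simp add: power2_eq_square algebra_simps)
    also have "\<dots> = y * (q0 + q2 / 2) - q1 / 2"
      unfolding ab y_eq c(1) using c(2) by simp
    also have "\<dots> = n0"
      using factors(1,3) by (simp add: field_simps)
    finally show "(a * c1)\<^sup>2 + (a * c2 - b * c1)\<^sup>2 + (a * c3 - b * c2)\<^sup>2 + (- b * c3)\<^sup>2 = n0" .
    have "2 * ((a * c1) * (a * c2 - b * c1) + (a * c2 - b * c1) * (a * c3 - b * c2)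
        + (a * c3 - b * c2) * (- b * c3))
      = (a * a + b * b) * (2 * (c1 * c2 + c2 * c3))
        - 2 * (a * b) * (c1\<^sup>2 + c2\<^sup>2 + c3\<^sup>2 + c1 * c3)"
      by (simp add: power2_eq_square algebra_simps)
    also have "\<dots> = y * q1 - (q0 + q2 / 2 + q2 / 4)"
      unfolding ab y_eq c(1,2) using c(3) by simp
    also have "\<dots> = n1"
      using factors(2,4) by simp
    finally show "2 * ((a * c1) * (a * c2 - b * c1) + (a * c2 - b * c1) * (a * c3 - b * c2)
        + (a * c3 - b * c2) * (- b * c3)) = n1" .
    have "2 * ((a * c1) * (a * c3 - b * c2) + (a * c2 - b * c1) * (- b * c3))
      = (a * a + b * b) * (2 * (c1 * c3)) - 2 * (a * b) * (c1 * c2 + c2 * c3)"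
      by (simp add: algebra_simps)
    also have "\<dots> = y * (q2 / 2) - q1 / 2"
      unfolding ab y_eq c(3) using c(2) by simp
    also have "\<dots> = n2"
      using factors(3) by simp
    finally show "2 * ((a * c1) * (a * c3 - b * c2) + (a * c2 - b * c1) * (- b * c3)) = n2" .
    have "2 * (a * c1 * (- b * c3)) = - (2 * (a * b)) * (c1 * c3)"
      by simp
    also have "\<dots> = n3"
      unfolding ab using c(3) factors(4) by simp
    finally show "2 * (a * c1 * (- b * c3)) = n3" .
  qed
qed

section \<open>Positive forms in few variables\<close>

lemma pos_form_2:
  fixes a b c x y :: real
  assumes "a > 0" "a * c > b\<^sup>2" "x \<noteq> 0 \<or> y \<noteq> 0"
  shows "a * x\<^sup>2 + 2 * b * (x * y) + c * y\<^sup>2 > 0"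
proof -
  have "a * (a * x\<^sup>2 + 2 * b * (x * y) + c * y\<^sup>2) = (a * x + b * y)\<^sup>2 + (a * c - b\<^sup>2) * y\<^sup>2"
    by (simp add: power2_eq_square algebra_simps)
  also have "\<dots> > 0"
    using assms by (cases "y = 0") (auto intro: add_nonneg_pos)
  finally show ?thesis
    using \<open>a > 0\<close> by (simp add: zero_less_mult_iff)
qed

lemma diagonally_dominant_form_3:
  fixes a b c p r s x y z :: real
  assumes "a > \<bar>p\<bar> + \<bar>r\<bar>" "b > \<bar>p\<bar> + \<bar>s\<bar>" "c > \<bar>r\<bar> + \<bar>s\<bar>"
    and "x \<noteq> 0 \<or> y \<noteq> 0 \<or> z \<noteq> 0"
  shows "a * x\<^sup>2 + b * y\<^sup>2 + c * z\<^sup>2 + 2 * (p * (x * y) + r * (x * z) + s * (y * z)) > 0"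
proof -
  have cross: "2 * (m * (u * v)) \<ge> - (\<bar>m\<bar> * (u\<^sup>2 + v\<^sup>2))" for m u v :: real
  proof -
    have "2 * \<bar>u * v\<bar> \<le> u\<^sup>2 + v\<^sup>2"
      using sum_squares_bound [of "\<bar>u\<bar>" "\<bar>v\<bar>"] by (simp add: abs_mult)
    then have "\<bar>m\<bar> * (2 * \<bar>u * v\<bar>) \<le> \<bar>m\<bar> * (u\<^sup>2 + v\<^sup>2)"
      by (simp add: mult_left_mono)
    moreover have "- (2 * (m * (u * v))) \<le> \<bar>m\<bar> * (2 * \<bar>u * v\<bar>)"
      by (metis abs_ge_minus_self abs_mult abs_numeral mult.left_commute)
    ultimately show ?thesis by linarith
  qed
  have "0 < (a - \<bar>p\<bar> - \<bar>r\<bar>) * x\<^sup>2 + (b - \<bar>p\<bar> - \<bar>s\<bar>) * y\<^sup>2 + (c - \<bar>r\<bar> - \<bar>s\<bar>) * z\<^sup>2"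
  proof -
    have nonneg: "(a - \<bar>p\<bar> - \<bar>r\<bar>) * x\<^sup>2 \<ge> 0" "(b - \<bar>p\<bar> - \<bar>s\<bar>) * y\<^sup>2 \<ge> 0" "(c - \<bar>r\<bar> - \<bar>s\<bar>) * z\<^sup>2 \<ge> 0"
      using assms(1-3) by simp_all
    have "(a - \<bar>p\<bar> - \<bar>r\<bar>) * x\<^sup>2 > 0 \<or> (b - \<bar>p\<bar> - \<bar>s\<bar>) * y\<^sup>2 > 0 \<or> (c - \<bar>r\<bar> - \<bar>s\<bar>) * z\<^sup>2 > 0"
      using assms by (auto simp: zero_less_mult_iff)
    with nonneg show ?thesis by linarith
  qed
  then show ?thesis
    using cross [of p x y] cross [of r x z] cross [of s y z]
    by (simp add: algebra_simps)
qed

lemma quad_expand: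
  "quad 2 m x = m 1 1 * (x 1)\<^sup>2 + (m 1 2 + m 2 1) * (x 1 * x 2) + m 2 2 * (x 2)\<^sup>2"
  "quad 3 m x = m 1 1 * (x 1)\<^sup>2 + m 2 2 * (x 2)\<^sup>2 + m 3 3 * (x 3)\<^sup>2
    + ((m 1 2 + m 2 1) * (x 1 * x 2) + (m 1 3 + m 3 1) * (x 1 * x 3) + (m 2 3 + m 3 2) * (x 2 * x 3))"
  by (simp_all add: quad_def numeral_eq_Suc algebra_simps)

lemma tail_gram_expand:
  "tail_gram c 1 1 = c 1 * c 1"
  "tail_gram c 1 2 = c 1 * c 2" "tail_gram c 2 1 = c 1 * c 2"
  "tail_gram c 1 3 = c 1 * c 3" "tail_gram c 3 1 = c 1 * c 3"
  "tail_gram c 2 2 = c 2 * c 2 + c 1 * c 1"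
  "tail_gram c 2 3 = c 2 * c 3 + c 1 * c 2" "tail_gram c 3 2 = c 2 * c 3 + c 1 * c 2"
  "tail_gram c 3 3 = c 3 * c 3 + c 2 * c 2 + c 1 * c 1"
  by (simp_all add: tail_gram_def numeral_eq_Suc)

section \<open>The four orders\<close>

lemma energy_identities_order_1: "has_energy_identities 1"
proof (rule energy_identities [where e = "\<lambda>_. 0" and f = "\<lambda>_. 1" and g = "\<lambda>_. 1" and c = "\<lambda>_. 1"])
  show "bdf_alpha 1 i = (if i = 0 then 0 else 1) - (if i = 1 then 0 else 1)" if "i \<le> 1" for i
    using that unfolding bdf_alpha_def bdf_coeffs_1 by (auto simp: le_Suc_eq)
  show "bdf_gamma 1 i = real 1 * 1" if "i < 1" for i
    using that unfolding bdf_gamma_def bdf_coeffs_1 by auto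
qed (auto simp: corr_def)

text \<open>
  Here \<open>|f|\<^sup>2 - |g|\<^sup>2 = (4/9) |\<zeta> - 1|\<^sup>2\<close>. Of the two signs of \<open>e\<close>, this one gives
  \<open>\<eta> = 0\<close>, so the multiplier is \<open>u\<^sub>2\<close> alone and \<open>A = 0\<close>.
\<close>

lemma energy_identities_order_2: "has_energy_identities 2"
proof (rule energy_identities [where e = "vec [2/3, -2/3]" and f = "vec [-2/3, 1]"
      and g = "vec [-1/3, 2/3]" and c = "vec [0, 1 / sqrt 3]"])
  show "bdf_alpha 2 i = (if i = 0 then 0 else vec [-2/3, 1] i)
      - (if i = 2 then 0 else vec [-1/3, 2/3] (i + 1))" if "i \<le> 2" for i
    using that unfolding bdf_alpha_def bdf_coeffs_2
    by (auto simp: vec_simps le_Suc_eq numeral_eq_Suc)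
  show "bdf_gamma 2 i = real 2 * vec [-1/3, 2/3] (i + 1)" if "i < 2" for i
    using that unfolding bdf_gamma_def bdf_coeffs_2
    by (auto simp: vec_simps less_Suc_eq numeral_eq_Suc)
  show "corr 2 (vec [2/3, -2/3]) l + corr 2 (vec [-1/3, 2/3]) l = corr 2 (vec [-2/3, 1]) l"
    if "l < 2" for l
    using that unfolding less_2_cases_iff
    by (auto simp: corr_def vec_simps numeral_eq_Suc)
  fix y :: "nat \<Rightarrow> real"
  assume "\<exists>i\<in>{1..2-1}. y i \<noteq> 0"
  then show "quad (2 - 1) (\<lambda>i j. tail_gram (vec [2/3, -2/3]) i j + tail_gram (vec [-1/3, 2/3]) i j
      - tail_gram (vec [-2/3, 1]) i j) y > 0"
    by (auto simp: quad_def tail_gram_def vec_simps zero_less_mult_iff)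
qed (auto simp: corr_def vec_simps numeral_eq_Suc real_div_sqrt less_Suc_eq)

text \<open>
  With \<open>h\<^sup>2 = 10/3\<close>, the spectral factor is
  \<open>e(\<zeta>) = (3/11) \<zeta> (\<zeta> - 1) ((1 - h) \<zeta> + (1 + h))\<close>. The linear factor has value 2 at
  \<open>\<zeta> = 1\<close> and \<open>2 h\<close> at \<open>\<zeta> = -1\<close>, which is what \<open>|f|\<^sup>2 - |g|\<^sup>2\<close>, divided by
  \<open>(3/11)\<^sup>2 |\<zeta> - 1|\<^sup>2\<close>, prescribes up to signs. For this choice of signs the multiplier has a concave cosine polynomial, and the determinant of
  \<open>K\<close> is visibly positive.
\<close>

lemma energy_identities_order_3: "has_energy_identities 3"
proof -
  define h where "h = sqrt (10 / 3)"
  have h2: "h * h = 10 / 3"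
    by (simp add: h_def)
  have h: "9 / 5 < h" "h < 11 / 6"
    unfolding h_def
    by (rule real_less_rsqrt, simp add: power2_eq_square)
      (rule real_less_lsqrt, simp_all add: power2_eq_square)
  define e where "e = vec [- (3/11) * (1 + h), (6/11) * h, (3/11) * (1 - h)]"
  define f where "f = vec [3/11, -12/11, 1]"
  define g where "g = vec [2/11, -6/11, 6/11]"
  have entries: "e 1 = - (3/11) * (1 + h)" "e 2 = (6/11) * h" "e 3 = (3/11) * (1 - h)"
    "f 1 = 3/11" "f 2 = -12/11" "f 3 = 1" "g 1 = 2/11" "g 2 = -6/11" "g 3 = 6/11"
    unfolding e_def f_def g_def by (simp_all add: vec_simps numeral_eq_Suc)
  have "(f 3 + e 3) + (f 2 + e 2) + (f 1 + e 1) \<ge> 0" "(f 3 + e 3) - (f 2 + e 2) + (f 1 + e 1) \<ge> 0"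
    "f 1 + e 1 \<le> 0 \<or> (f 2 + e 2)\<^sup>2 \<le> 8 * (f 1 + e 1) * ((f 3 + e 3) - (f 1 + e 1))"
    using h unfolding entries by (simp_all add: field_simps)
  then obtain c1 c2 c3 where c: "c1\<^sup>2 + c2\<^sup>2 + c3\<^sup>2 = f 3 + e 3"
    "2 * (c1 * c2 + c2 * c3) = f 2 + e 2" "2 * (c1 * c3) = f 1 + e 1"
    by (rule fejer_riesz_2)
  have c_entries: "vec [c1, c2, c3] 1 = c1" "vec [c1, c2, c3] 2 = c2" "vec [c1, c2, c3] 3 = c3"
    by (simp_all add: vec_simps numeral_eq_Suc)
  show ?thesis
  proof (rule energy_identities [where e = e and f = f and g = g and c = "vec [c1, c2, c3]"])
    show "bdf_alpha 3 i = (if i = 0 then 0 else f i) - (if i = 3 then 0 else g (i + 1))"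
      if "i \<le> 3" for i
      using that unfolding bdf_alpha_def bdf_coeffs_3 f_def g_def
      by (auto simp: vec_simps le_Suc_eq numeral_eq_Suc)
    show "bdf_gamma 3 i = real 3 * g (i + 1)" if "i < 3" for i
      using that unfolding bdf_gamma_def bdf_coeffs_3 g_def
      by (auto simp: vec_simps less_Suc_eq numeral_eq_Suc)
    show "corr 3 e l + corr 3 g l = corr 3 f l" if "l < 3" for l
    proof -
      have "l = 0 \<or> l = 1 \<or> l = 2"
        using that by auto
      then show ?thesis
        using h2 by (auto simp: corr_expand entries field_simps simp del: One_nat_def)
    qed
    show "f 3 + e 3 > 0"
      using h unfolding entries by (simp add: field_simps)
    show "corr 3 (vec [c1, c2, c3]) 0 = f 3 + e 3"
      using c(1) by (simp only: corr_expand c_entries power2_eq_square)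
    show "2 * corr 3 (vec [c1, c2, c3]) l = f (3 - l) + e (3 - l)" if "1 \<le> l" "l < 3" for l
    proof -
      have "l = 1 \<or> l = 2"
        using that by auto
      then show ?thesis
        using c(2,3) by (auto simp: corr_expand c_entries simp flip: One_nat_def)
    qed
    fix y :: "nat \<Rightarrow> real"
    assume y: "\<exists>i\<in>{1..3-1}. y i \<noteq> 0"
    have y12: "y 1 \<noteq> 0 \<or> y 2 \<noteq> 0"
    proof -
      have "{1..3-1} = {1, 2::nat}"
        by auto
      then show ?thesis
        using y by auto
    qed
    let ?m = "\<lambda>i j. tail_gram e i j + tail_gram g i j - tail_gram f i j"
    let ?a = "(36/121) * (17/18 + h/2)" and ?b = "- (36/121) * (1 + h/2)"
      and ?c = "(36/121) * (23/18 + h/2)"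
    have m: "?m 1 1 = ?a" "?m 1 2 = ?b" "?m 2 1 = ?b" "?m 2 2 = ?c"
      unfolding tail_gram_expand entries using h2 by (simp_all add: field_simps)
    have "?a * ?c - ?b\<^sup>2 = (36/121)\<^sup>2 * (67/324 + h/9)"
      by (simp add: power2_eq_square algebra_simps)
    also have "\<dots> > 0"
      using h by (simp add: add_pos_pos)
    finally have "?a * (y 1)\<^sup>2 + 2 * ?b * (y 1 * y 2) + ?c * (y 2)\<^sup>2 > 0"
      using h y12 by (intro pos_form_2) auto
    moreover have "quad (3 - 1) ?m y = ?m 1 1 * (y 1)\<^sup>2 + (?m 1 2 + ?m 2 1) * (y 1 * y 2) + ?m 2 2 * (y 2)\<^sup>2"
      using quad_expand(1) [of ?m y] by simp
    ultimately show "quad (3 - 1) ?m y > 0"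
      unfolding m by simp
  qed (simp_all add: entries del: One_nat_def)
qed

text \<open>
  The spectral factor is
  \<open>e(\<zeta>) = - (6/25) \<zeta> (\<zeta> - 1) ((S + D) \<zeta>\<^sup>2 + 2 (1 - S) \<zeta> + (S - D))\<close>. After
  division by \<open>2\<close>, the quadratic factor \<open>\<rho>\<close> is determined, up to signs and reversal, by
  \<open>|\<rho>(1)|\<^sup>2 = 1\<close>, \<open>|\<rho>(-1)|\<^sup>2 = 76/9\<close> and the product 4/9 of its outer coefficients; hence
  \<open>S = 1/2 + sqrt 19 / 3\<close> is their sum and \<open>D = sqrt (S\<^sup>2 - 16/9)\<close> their difference. The
  reversed factor is unusable, because its multiplier has a cosine polynomial with negative values.

  The inequalities are checked numerically: the coefficients of \<open>K\<close> and of the cosine polynomial are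
  linear in \<open>S\<close>, \<open>D\<close> and \<open>S D\<close>, so enclosures of these three numbers suffice.
\<close>

lemma energy_identities_order_4: "has_energy_identities 4"
proof -
  define S where "S = 1/2 + sqrt 19 / 3"
  define D where "D = sqrt (S + 1/12)"
  have S2: "S * S = S + 67/36"
    by (simp add: S_def field_simps)
  have S: "1.95296631 < S" "S < 1.95296632"
  proof -
    have "4.35889893 < sqrt 19" "sqrt 19 < 4.35889896"
      by (rule real_less_rsqrt, simp add: power2_eq_square)
        (rule real_less_lsqrt, simp_all add: power2_eq_square)
    then show "1.95296631 < S" "S < 1.95296632"
      by (simp_all add: S_def)
  qed
  have D2: "D * D = S + 1/12"
    using S by (simp add: D_def)
  have D: "1.42698970 < D" "D < 1.42698973"
    unfolding D_def using S
    by - (rule real_less_rsqrt, simp add: power2_eq_square,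
      rule real_less_lsqrt, simp_all add: power2_eq_square)
  define w where "w = S * D"
  have w: "1.95296631 * 1.42698970 < w" "w < 1.95296632 * 1.42698973"
    unfolding w_def using S D by (intro mult_strict_mono; simp)+
  define e where "e = vec [(6/25) * (S - D), (6/25) * (2 - 3 * S + D), (6/25) * (3 * S + D - 2), - (6/25) * (S + D)]"
  define f where "f = vec [-4/25, 18/25, -36/25, 1]"
  define g where "g = vec [-3/25, 12/25, -18/25, 12/25]"
  have entries: "e 1 = (6/25) * (S - D)" "e 2 = (6/25) * (2 - 3 * S + D)"
    "e 3 = (6/25) * (3 * S + D - 2)" "e 4 = - (6/25) * (S + D)"
    "f 1 = -4/25" "f 2 = 18/25" "f 3 = -36/25" "f 4 = 1"
    "g 1 = -3/25" "g 2 = 12/25" "g 3 = -18/25" "g 4 = 12/25"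
    unfolding e_def f_def g_def by (simp_all add: vec_simps numeral_eq_Suc)
  define n0 n1 n2 n3 where n: "n0 = f 4 + e 4" "n1 = f 3 + e 3" "n2 = f 2 + e 2" "n3 = f 1 + e 1"
  \<comment> \<open>The cosine polynomial of the scaled multiplier, as a cubic in \<open>y = cos \<theta>\<close>. It is
    positive on \<open>[-1, 1]\<close> and has one real root, near 1.85.\<close>
  define P where "P = (\<lambda>y. n0 - n2 + (n1 - 3 * n3) * y + 2 * n2 * y\<^sup>2 + 4 * n3 * y ^ 3)"
  have "P (19/10) \<le> 0" "P (9/5) \<ge> 0"
    using S D unfolding P_def n entries by (simp_all add: field_simps eval_nat_numeral)
  moreover have "continuous_on {9/5..19/10} P"
    unfolding P_def by (intro continuous_intros)
  ultimately obtain Y where Y: "9/5 \<le> Y" "Y \<le> 19/10" "P Y = 0"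
    using IVT2' [of P "19/10" 0 "9/5"] by auto
  define q2 q1 q0 where "q2 = - 4 * n3" and "q1 = Y * q2 - 2 * n2" and "q0 = Y * q1 - n1 + 3 * n3"
  have "n0 - n2 = Y * q0"
    using \<open>P Y = 0\<close> by (simp add: P_def q0_def q1_def q2_def eval_nat_numeral algebra_simps)
  then have factors: "n0 - n2 = Y * q0" "n1 - 3 * n3 = Y * q1 - q0" "2 * n2 = Y * q2 - q1"
      "4 * n3 = - q2"
    by (simp_all add: q0_def q1_def q2_def)
  have q2: "27/200 \<le> q2" "q2 \<le> 1351/10000"
    using S D unfolding q2_def n entries by (simp_all add: field_simps)
  have n2: "1363/10000 \<le> n2" "n2 \<le> 1364/10000"
    using S D unfolding n entries by (simp_all add: field_simps)
  have q1: "\<bar>q1\<bar> \<le> 3/100"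
  proof -
    have "9/5 * (27/200) \<le> Y * q2" "Y * q2 \<le> 19/10 * (1351/10000)"
      using Y q2 by (intro mult_mono; simp)+
    then show ?thesis
      using n2 unfolding q1_def by (simp add: abs_le_iff)
  qed
  have q0: "1/50 \<le> q0"
  proof (rule ccontr)
    assume "\<not> 1/50 \<le> q0"
    then have "Y * q0 \<le> Y * (1/50)"
      using Y by (intro mult_left_mono) auto
    also have "\<dots> \<le> 19/500"
      using Y by simp
    finally show False
      using S D unfolding factors(1) [symmetric] n entries by (simp add: field_simps)
  qed
  have nonneg: "q0 + q1 + q2 \<ge> 0" "q0 - q1 + q2 \<ge> 0"
    using q0 q1 q2 by linarith+
  have discriminant: "q1\<^sup>2 \<le> 4 * q0 * q2"
  proof -
    have "q1\<^sup>2 \<le> (3/100)\<^sup>2"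
      using q1 by (metis abs_le_square_iff abs_numeral abs_of_nonneg order_trans abs_ge_zero)
    moreover have "1/50 * (27/200) \<le> q0 * q2"
      using q0 q2 by (intro mult_mono) auto
    ultimately show ?thesis
      by (simp add: power2_eq_square)
  qed
  have "Y \<ge> 1" "q2 \<le> 0 \<or> q1\<^sup>2 \<le> 4 * q0 * q2"
    using Y(1) discriminant by simp_all
  with nonneg obtain c1 c2 c3 c4
    where c: "c1\<^sup>2 + c2\<^sup>2 + c3\<^sup>2 + c4\<^sup>2 = n0" "2 * (c1 * c2 + c2 * c3 + c3 * c4) = n1"
      "2 * (c1 * c3 + c2 * c4) = n2" "2 * (c1 * c4) = n3"
    using fejer_riesz_3 [OF factors] by metis
  let ?c = "vec [c1, c2, c3, c4]"
  have c_entries: "?c 1 = c1" "?c 2 = c2" "?c 3 = c3" "?c 4 = c4"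
    by (simp_all add: vec_simps numeral_eq_Suc)
  show ?thesis
  proof (rule energy_identities [where e = e and f = f and g = g and c = ?c])
    show "bdf_alpha 4 i = (if i = 0 then 0 else f i) - (if i = 4 then 0 else g (i + 1))"
      if "i \<le> 4" for i
      using that unfolding bdf_alpha_def bdf_coeffs_4 f_def g_def
      by (auto simp: vec_simps le_Suc_eq numeral_eq_Suc)
    show "bdf_gamma 4 i = real 4 * g (i + 1)" if "i < 4" for i
      using that unfolding bdf_gamma_def bdf_coeffs_4 g_def
      by (auto simp: vec_simps less_Suc_eq numeral_eq_Suc)
    show "corr 4 e l + corr 4 g l = corr 4 f l" if "l < 4" for l
    proof -
      have "l = 0 \<or> l = 1 \<or> l = 2 \<or> l = 3"
        using that by auto
      then show ?thesis
        using S2 D2 by (auto simp: corr_expand entries field_simps simp del: One_nat_def)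
    qed
    show "f 4 + e 4 > 0"
      using S D unfolding entries by simp
    show "corr 4 ?c 0 = f 4 + e 4"
      using c(1) by (simp only: corr_expand c_entries power2_eq_square n)
    show "2 * corr 4 ?c l = f (4 - l) + e (4 - l)" if "1 \<le> l" "l < 4" for l
    proof -
      have "l = 1 \<or> l = 2 \<or> l = 3"
        using that by auto
      then show ?thesis
        using c(2-4) by (auto simp: corr_expand c_entries n simp flip: One_nat_def)
    qed
    fix y :: "nat \<Rightarrow> real"
    assume y: "\<exists>i\<in>{1..4-1}. y i \<noteq> 0"
    have y123: "y 1 \<noteq> 0 \<or> y 2 \<noteq> 0 \<or> y 3 \<noteq> 0"
    proof -
      have "{1..4-1} = {1, 2, 3::nat}"
        by auto
      then show ?thesis
        using y by auto
    qed
    let ?m = "\<lambda>i j. tail_gram e i j + tail_gram g i j - tail_gram f i j"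
    \<comment> \<open>The entries of \<open>K\<close>, scaled by the square of 25/12. The relations for \<open>S\<^sup>2\<close> and
      \<open>D\<^sup>2\<close> make them linear in \<open>S\<close>, the smaller outer coefficient \<open>r\<close> of \<open>\<rho>\<close>, and
      \<open>z = S r\<close>.\<close>
    define r where "r = (S - D) / 2"
    define z where "z = (S + 67/36 - w) / 2"
    define k11 where "k11 = z - 71/144"
    define k12 where "k12 = r - 2 * z + 25/36"
    define k13 where "k13 = z - r - 13/72"
    define k22 where "k22 = 4 * z - 2 * r - S + 97/144"
    define k23 where "k23 = r - 2 * z + S - 53/36"
    define k33 where "k33 = k22 + 2 * r - 3 * z + 5/4"
    have SD: "S * D = w" "D * S = w"
      by (simp_all add: w_def)
    note k_defs = k11_def k12_def k13_def k22_def k23_def k33_def r_def z_def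
    have m: "?m 1 1 = (144/625) * k11" "?m 1 2 = (144/625) * k12" "?m 2 1 = (144/625) * k12"
      "?m 1 3 = (144/625) * k13" "?m 3 1 = (144/625) * k13" "?m 2 2 = (144/625) * k22"
      "?m 2 3 = (144/625) * k23" "?m 3 2 = (144/625) * k23" "?m 3 3 = (144/625) * k33"
      unfolding tail_gram_expand entries k_defs using S2 D2 SD by (simp_all add: field_simps)
    \<comment> \<open>A rounded Cholesky factor: in the variables \<open>x1\<close>, \<open>x2\<close>, \<open>y 3\<close> the matrix of
      \<open>K\<close> is nearly diagonal. The diagonal entries are about 0.021, 0.012 and 0.075.\<close>
    define t12 where "t12 = 17/5 * k11 + k12"
    define t13 where "t13 = 46/5 * k11 + 37/10 * k12 + k13"
    define t22 where "t22 = 17/5 * t12 + 17/5 * k12 + k22"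
    define t23 where "t23 = 17/5 * t13 + 46/5 * k12 + 37/10 * k22 + k23"
    define t33 where "t33 = 46/5 * t13 + 37/10 * (46/5 * k12 + 37/10 * k22 + k23) + 46/5 * k13 + 37/10 * k23 + k33"
    note t_defs = t12_def t13_def t22_def t23_def t33_def
    define x1 where "x1 = y 1 - 17/5 * y 2 + 169/50 * y 3"
    define x2 where "x2 = y 2 - 37/10 * y 3"
    have "\<bar>t12\<bar> < 0.001" "\<bar>t13\<bar> < 0.001" "\<bar>t23\<bar> < 0.001" "k11 > 0.01" "t22 > 0.01" "t33 > 0.01"
      using S D w unfolding t_defs k_defs abs_less_iff by (simp_all add: field_simps)
    moreover have "x1 \<noteq> 0 \<or> x2 \<noteq> 0 \<or> y 3 \<noteq> 0"
      using y123 by (auto simp: x1_def x2_def)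
    ultimately have "k11 * x1\<^sup>2 + t22 * x2\<^sup>2 + t33 * (y 3)\<^sup>2
        + 2 * (t12 * (x1 * x2) + t13 * (x1 * y 3) + t23 * (x2 * y 3)) > 0"
      by (intro diagonally_dominant_form_3) auto
    also have "k11 * x1\<^sup>2 + t22 * x2\<^sup>2 + t33 * (y 3)\<^sup>2
        + 2 * (t12 * (x1 * x2) + t13 * (x1 * y 3) + t23 * (x2 * y 3))
        = k11 * (y 1)\<^sup>2 + k22 * (y 2)\<^sup>2 + k33 * (y 3)\<^sup>2
        + 2 * (k12 * (y 1 * y 2) + k13 * (y 1 * y 3) + k23 * (y 2 * y 3))"
      unfolding x1_def x2_def t_defs by (simp add: power2_eq_square field_simps)
    also have "\<dots> = quad (4 - 1) ?m y / (144/625)"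
      using quad_expand(2) [of ?m y] unfolding m by simp
    finally show "quad (4 - 1) ?m y > 0"
      by simp
  qed (simp_all add: entries del: One_nat_def)
qed

theorem lemma3p5:
  fixes q :: nat
  assumes "q \<in> {1, 2, 3, 4}"
  shows "\<exists>(g :: nat \<Rightarrow> nat \<Rightarrow> real) (a :: nat \<Rightarrow> nat \<Rightarrow> real)
           (\<eta> :: nat \<Rightarrow> real) (c :: nat \<Rightarrow> real) (d1 :: real) (d2 :: real).
      pos_def_hermitian q (\<lambda>i j. complex_of_real (g i j)) \<and>
      pos_semidef_hermitian (q - 1) (\<lambda>i j. complex_of_real (a i j)) \<and>
      d1 > 0 \<and>
      (\<forall>u :: nat \<Rightarrow> complex.
        complex_of_real (Re ((cnj (u q) - (\<Sum>j=1..q-1. complex_of_real (\<eta> j) * cnj (u j))) *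
                             (\<Sum>i=0..q. complex_of_real (bdf_alpha q i) * u i)))
        = sesq_form q (\<lambda>i j. complex_of_real (g i j)) u
          - sesq_form q (\<lambda>i j. complex_of_real (g i j)) (\<lambda>i. u (i - 1))
          + complex_of_real (d1 * (cmod (u q - (\<Sum>i=1..q-1. complex_of_real (\<eta> i) * u i)
              - complex_of_real d2 * (\<Sum>i=0..q-1. complex_of_real (bdf_gamma q i) * u i)))\<^sup>2)
        \<and>
        complex_of_real (Re ((cnj (u q) - (\<Sum>i=1..q-1. complex_of_real (\<eta> i) * cnj (u i))) * u q))
        = sesq_form (q - 1) (\<lambda>i j. complex_of_real (a i j)) (\<lambda>i. u (i + 1))
          - sesq_form (q - 1) (\<lambda>i j. complex_of_real (a i j)) u
          + complex_of_real ((cmod (\<Sum>i=1..q. complex_of_real (c i) * u i))\<^sup>2))"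
proof -
  have "has_energy_identities q"
    using assms energy_identities_order_1 energy_identities_order_2
      energy_identities_order_3 energy_identities_order_4
    by auto
  then show ?thesis
    unfolding has_energy_identities_def .
qed

end
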